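(* Let $\mathcal{P}^+\subset\mathrm{Sym}^2(\mathbb{R}^n)$ be a closed convex cone (with vertex at the origin) satisfying the Positivity Condition. Suppose that $\Omega\subset\subset\mathbb{R}^n$ is a domain with a smooth, strictly $\mathcal{P}^+$-convex boundary. Then $\Omega$ is a $\mathcal{P}^+$-convex domain.
   Context: $\mathrm{Sym}^2(\mathbb{R}^n)$ is the space of quadratic forms on $\mathbb{R}^n$ (real symmetric $n\times n$ matrices) with inner product $\langle A,B\rangle=\mathrm{tr}(AB)$, and $\mathcal{P}=\{A:A\ge0\}$. The polar of $\mathcal{P}^+$ is $\mathcal{P}_+=\{A:\langle A,B\rangle\ge0\ \forall B\in\mathcal{P}^+\}$. Positivity Condition: every $A\in\mathcal{P}_+$ is $\ge0$, equivalently $\mathcal{P}\subset\mathcal{P}^+$. For a linear subspace $W\subset\mathbb{R}^n$, $\mathrm{Sym}^2(W)$ is regarded as the subspace of $\mathrm{Sym}^2(\mathbb{R}^n)$ of those $A$ vanishing on $W^\perp$. $\Omega\subset\subset\mathbb{R}^n$ means $\Omega$ is bounded; a domain is a connected open set. A defining function for $\partial\Omega$ is a smooth function $\rho$ on a neighborhood of $\partial\Omega$ such that in this neighborhood $\Omega=\{\rho<0\}$, and $\nabla\rho\ne0$ on $\partial\Omega$. $A\in\mathcal{P}_+$ is tangential at $x\in\partial\Omega$ if $A\in\mathrm{Sym}^2(T_x\partial\Omega)$. $\partial\Omega$ is strictly $\mathcal{P}^+$-convex at $x$ if $\langle\mathrm{Hess}_x\rho,A\rangle>0$ for all non-zero $A\in\mathcal{P}_+$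 tangential at $x$ (independent of the choice of $\rho$), and strictly $\mathcal{P}^+$-convex if this holds at every $x\in\partial\Omega$. $\mathrm{PSH}^\infty(\Omega)$ is the set of $u\in C^\infty(\Omega)$ with $\mathrm{Hess}_xu\in\mathcal{P}^+$ for all $x\in\Omega$. For compact $K\subset\Omega$, $\widehat K=\{x\in\Omega:u(x)\le\sup_Ku\ \text{for all }u\in\mathrm{PSH}^\infty(\Omega)\}$. $\Omega$ is a $\mathcal{P}^+$-convex domain if $\widehat K$ is relatively compact in $\Omega$ for every compact $K\subset\Omega$; equivalently, $\Omega$ admits a $C^\infty$ proper exhaustion function $u$ with $\mathrm{Hess}_xu\in\mathrm{Int}\,\mathcal{P}^+$ for all $x$. *)

theory Defs
  imports "HOL-Analysis.Analysis"
begin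

section \<open>Smooth functions, gradient and Hessian\<close>

definition partial_at :: "'n::finite \<Rightarrow> (real^'n \<Rightarrow> real) \<Rightarrow> real^'n \<Rightarrow> real" where
  "partial_at i f x = frechet_derivative f (at x) (axis i 1)"

text \<open>
  The next two notions are meant for open \<open>S\<close> only: derivatives are taken in the full space.
\<close>

primrec Ck_on :: "nat \<Rightarrow> (real^'n::finite \<Rightarrow> real) \<Rightarrow> (real^'n) set \<Rightarrow> bool" where
  "Ck_on 0 f S \<longleftrightarrow> continuous_on S f"
| "Ck_on (Suc k) f S \<longleftrightarrow>
     (\<forall>x\<in>S. f differentiable (at x)) \<and> (\<forall>i. Ck_on k (partial_at i f) S)"

definition smooth_on :: "(real^'n::finite) set \<Rightarrow> (real^'n \<Rightarrow> real) \<Rightarrow> bool" where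
  "smooth_on S f \<longleftrightarrow> (\<forall>k. Ck_on k f S)"

definition grad :: "(real^'n::finite \<Rightarrow> real) \<Rightarrow> real^'n \<Rightarrow> real^'n" where
  "grad f x = (\<chi> i. partial_at i f x)"

definition hess :: "(real^'n::finite \<Rightarrow> real) \<Rightarrow> real^'n \<Rightarrow> real^'n^'n" where
  "hess f x = (\<chi> i j. partial_at i (partial_at j f) x)"


section \<open>Cones of quadratic forms\<close>

definition Sym2 :: "(real^'n::finite^'n) set" where
  "Sym2 = {A. transpose A = A}"

definition sym_ip :: "real^'n::finite^'n \<Rightarrow> real^'n^'n \<Rightarrow> real" where
  "sym_ip A B = trace (A ** B)"

definition nonneg_form :: "real^'n::finite^'n \<Rightarrow> bool" where
  "nonneg_form A \<longleftrightarrow> A \<in> Sym2 \<and> (\<forall>v. 0 \<le> v \<bullet> (A *v v))"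

definition polar_cone :: "(real^'n::finite^'n) set \<Rightarrow> (real^'n^'n) set" where
  "polar_cone P = {A \<in> Sym2. \<forall>B\<in>P. 0 \<le> sym_ip A B}"

definition positivity_condition :: "(real^'n::finite^'n) set \<Rightarrow> bool" where
  "positivity_condition P \<longleftrightarrow> (\<forall>A\<in>polar_cone P. nonneg_form A)"

text \<open>
  \<open>Sym\<^sup>2(W)\<close> as a subspace of \<open>Sym\<^sup>2(\<real>\<^sup>n)\<close>: a form vanishes on \<open>W\<^sup>\<bottom>\<close> when \<open>W\<^sup>\<bottom>\<close> lies in its
  null space. Vanishing of the mere restriction to \<open>W\<^sup>\<bottom>\<close> would still allow mixed terms between
  \<open>W\<close> and \<open>W\<^sup>\<bottom>\<close>.
\<close>

definition Sym2_of :: "(real^'n::finite) set \<Rightarrow> (real^'n^'n) set" where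
  "Sym2_of W = {A \<in> Sym2. \<forall>w\<in>orthogonal_comp W. A *v w = 0}"


section \<open>Strictly convex boundaries\<close>

definition defining_function ::
  "(real^'n::finite) set \<Rightarrow> (real^'n) set \<Rightarrow> (real^'n \<Rightarrow> real) \<Rightarrow> bool" where
  "defining_function \<Omega> U \<rho> \<longleftrightarrow>
     open U \<and> frontier \<Omega> \<subseteq> U \<and> smooth_on U \<rho> \<and>
     \<Omega> \<inter> U = {x \<in> U. \<rho> x < 0} \<and> (\<forall>x\<in>frontier \<Omega>. grad \<rho> x \<noteq> 0)"

definition smooth_boundary :: "(real^'n::finite) set \<Rightarrow> bool" where
  "smooth_boundary \<Omega> \<longleftrightarrow> (\<exists>U \<rho>. defining_function \<Omega> U \<rho>)"

text \<open>
  For a defining function \<open>\<rho>\<close> of \<open>\<partial>\<Omega>\<close> and \<open>x \<in> \<partial>\<Omega>\<close> this is \<open>T\<^sub>x\<partial>\<Omega>\<close>, the kernel of \<open>d\<rho>\<close> at \<open>x\<close>.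
\<close>

definition tangent_space :: "(real^'n::finite \<Rightarrow> real) \<Rightarrow> real^'n \<Rightarrow> (real^'n) set" where
  "tangent_space \<rho> x = {v. grad \<rho> x \<bullet> v = 0}"

text \<open>
  The condition on \<open>\<rho>\<close> below holds for one defining function iff it holds for all of them. The
  existential form, chosen separately at each boundary point, is the weakest hypothesis.
\<close>

definition strictly_convex_at ::
  "(real^'n::finite^'n) set \<Rightarrow> (real^'n) set \<Rightarrow> real^'n \<Rightarrow> bool" where
  "strictly_convex_at P \<Omega> x \<longleftrightarrow>
     (\<exists>U \<rho>. defining_function \<Omega> U \<rho> \<and>
       (\<forall>A\<in>polar_cone P. A \<in> Sym2_of (tangent_space \<rho> x) \<longrightarrow> A \<noteq> 0 \<longrightarrow>
          0 < sym_ip (hess \<rho> x) A))"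

definition strictly_convex_boundary ::
  "(real^'n::finite^'n) set \<Rightarrow> (real^'n) set \<Rightarrow> bool" where
  "strictly_convex_boundary P \<Omega> \<longleftrightarrow> (\<forall>x\<in>frontier \<Omega>. strictly_convex_at P \<Omega> x)"


section \<open>Convex domains\<close>

definition PSH :: "(real^'n::finite^'n) set \<Rightarrow> (real^'n) set \<Rightarrow> (real^'n \<Rightarrow> real) set" where
  "PSH P \<Omega> = {u. smooth_on \<Omega> u \<and> (\<forall>x\<in>\<Omega>. hess u x \<in> P)}"

text \<open>
  For \<open>K = {}\<close> the supremum is an unspecified real number. If \<open>0 \<in> P\<close>, all constants are in
  \<open>PSH P \<Omega>\<close>, so the hull of the empty set is then empty, in agreement with \<open>sup \<emptyset> = -\<infinity>\<close>.
\<close>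

definition psh_hull :: "(real^'n::finite^'n) set \<Rightarrow> (real^'n) set \<Rightarrow> (real^'n) set \<Rightarrow> (real^'n) set"
  where "psh_hull P \<Omega> K = {x \<in> \<Omega>. \<forall>u\<in>PSH P \<Omega>. u x \<le> (SUP y\<in>K. u y)}"

definition convex_domain :: "(real^'n::finite^'n) set \<Rightarrow> (real^'n) set \<Rightarrow> bool" where
  "convex_domain P \<Omega> \<longleftrightarrow>
     open \<Omega> \<and> connected \<Omega> \<and>
     (\<forall>K. compact K \<and> K \<subseteq> \<Omega> \<longrightarrow>
        compact (closure (psh_hull P \<Omega> K)) \<and> closure (psh_hull P \<Omega> K) \<subseteq> \<Omega>)"

end

theory Submission
  imports Defs "HOL-Computational_Algebra.Polynomial"
begin

text \<open>
  The hull of a compact set \<open>K\<close> is bounded, so it suffices that no boundary point \<open>x0\<close> lies in its closure.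
  This is shown by a barrier: a function in \<open>PSH P \<Omega>\<close> that is zero away from a prescribed small
  neighbourhood of \<open>x0\<close>, in particular on \<open>K\<close>, but positive at all points of \<open>\<Omega>\<close> close to \<open>x0\<close>
  (\<open>boundary_barrier\<close>).

  The barrier is built from a defining function \<open>\<rho>\<close>. Strict convexity says that the Hessian of \<open>\<rho>\<close> at
  \<open>x0\<close> pairs positively with the nonzero tangential elements of the polar cone. By the Positivity Condition the
  elements of the polar cone are nonnegative forms, and such a form fails to be tangential exactly
  when it is positive on the normal \<open>grad \<rho> x0\<close>. A compactness argument (\<open>polar_cone_margin\<close>)
  therefore yields \<open>l > 0\<close> such that \<open>hess \<rho> x0 + l *\<^sub>R outer (grad \<rho> x0)\<close> is interior to \<open>P\<close>
  relative to \<open>Sym2\<close>. This matrix is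
  the Hessian at \<open>x0\<close> of \<open>(exp (l * \<rho>) - 1) / l\<close>, and the Hessian remains in \<open>P\<close> near \<open>x0\<close> after subtracting
  a small multiple \<open>c\<close> of the squared distance to \<open>x0\<close>. The function \<open>\<phi>\<close> so obtained vanishes at \<open>x0\<close>
  and is at most \<open>- c * (dist x0 x)\<^sup>2\<close> at the points \<open>x\<close> of \<open>\<Omega>\<close> near \<open>x0\<close>, so \<open>\<phi> > - \<epsilon>\<close> holds there only very
  close to \<open>x0\<close>. Composing \<open>\<phi> + \<epsilon>\<close> with a smooth function that is zero on the negative axis and
  increasing and convex on \<open>[0, 1/2]\<close> makes the function zero outside this small region, and it can be
  extended by zero.

  That Hessians belong to \<open>P\<close> is checked by duality: a symmetric matrix is in \<open>P\<close> if it pairs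
  nonnegatively with every element of the polar cone (\<open>mem_cone_if_polar_nonneg\<close>). The symmetry of Hessians, that is
  Clairaut's theorem, enters here (\<open>hess_symmetric\<close>).
\<close>

section \<open>Calculus of smooth functions\<close>

lemma partial_at_eqI:
  "(f has_derivative f') (at x) \<Longrightarrow> partial_at i f x = f' (axis i 1)"
  unfolding partial_at_def using frechet_derivative_at by metis

lemma Ck_on_SucD: "Ck_on (Suc k) f S \<Longrightarrow> Ck_on k f S"
proof (induction k arbitrary: f)
  case 0
  then show ?case
    by (auto intro!: continuous_at_imp_continuous_on differentiable_imp_continuous_within)
next
  case (Suc k)
  then show ?case by (meson Ck_on.simps(2))
qed

lemma smooth_on_iff:
  "smooth_on S f \<longleftrightarrow> (\<forall>x\<in>S. f differentiable (at x)) \<and> (\<forall>i. smooth_on S (partial_at i f))"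
  unfolding smooth_on_def
  by (metis Ck_on.simps(2) Ck_on_SucD)

lemma smooth_on_differentiable: "smooth_on S f \<Longrightarrow> x \<in> S \<Longrightarrow> f differentiable (at x)"
  by (simp add: smooth_on_iff[of S f])

lemma smooth_on_partial_at: "smooth_on S f \<Longrightarrow> smooth_on S (partial_at i f)"
  by (simp add: smooth_on_iff[of S f])

lemma smooth_on_imp_continuous_on: "smooth_on S f \<Longrightarrow> continuous_on S f"
  unfolding smooth_on_def by (metis Ck_on.simps(1))

lemma Ck_on_subset: "Ck_on k f S \<Longrightarrow> T \<subseteq> S \<Longrightarrow> Ck_on k f T"
  by (induction k arbitrary: f) (auto intro: continuous_on_subset)

lemma smooth_on_subset: "smooth_on S f \<Longrightarrow> T \<subseteq> S \<Longrightarrow> smooth_on T f"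
  unfolding smooth_on_def using Ck_on_subset by blast

lemma partial_at_cong:
  assumes "f differentiable (at x)" "open S" "x \<in> S" "\<And>y. y \<in> S \<Longrightarrow> f y = g y"
  shows "partial_at i f x = partial_at i g x"
  unfolding partial_at_def
  using frechet_derivative_transform_within_open[OF assms(1-3), of g] assms(4) by metis

lemma Ck_on_cong:
  assumes "open S" "\<And>y. y \<in> S \<Longrightarrow> f y = g y" "Ck_on k f S"
  shows "Ck_on k g S"
  using assms(2,3)
proof (induction k arbitrary: f g)
  case 0
  then show ?case by (simp cong: continuous_on_cong)
next
  case (Suc k)
  have "g differentiable (at x)" if x: "x \<in> S" for x
  proof -
    obtain f' where "(f has_derivative f') (at x)"
      using Suc.prems(2) x by (auto simp: differentiable_def)
    from has_derivative_transform_within_open[OF this assms(1) x Suc.prems(1)]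
    show ?thesis unfolding differentiable_def by blast
  qed
  moreover have "Ck_on k (partial_at i g) S" for i
    by (rule Suc.IH[of "partial_at i f"])
       (use Suc.prems assms(1) in \<open>auto intro!: partial_at_cong\<close>)
  ultimately show ?case by simp
qed

lemma smooth_on_cong:
  assumes "open S" "\<And>y. y \<in> S \<Longrightarrow> f y = g y" "smooth_on S f"
  shows "smooth_on S g"
  using assms Ck_on_cong unfolding smooth_on_def by blast

text \<open>
  The Hessian depends only on the germ of the function. This and the union lemma below make it
  possible to treat a function that is given by different formulas on different open sets.
\<close>

lemma hess_cong:
  assumes "smooth_on S f" "open S" "x \<in> S" "\<And>y. y \<in> S \<Longrightarrow> f y = g y"
  shows "hess f x = hess g x"
proof -
  have d: "f differentiable (at y)" if "y \<in> S" for y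
    using smooth_on_differentiable[OF assms(1) that] .
  have d2: "partial_at j f differentiable (at x)" for j
    using smooth_on_differentiable[OF smooth_on_partial_at[OF assms(1)] assms(3)] .
  have "partial_at j f y = partial_at j g y" if "y \<in> S" for j y
    using partial_at_cong[OF d[OF that] assms(2) that assms(4)] .
  then have "partial_at i (partial_at j f) x = partial_at i (partial_at j g) x" for i j
    by (intro partial_at_cong[OF d2 assms(2,3)])
  then show ?thesis by (simp add: hess_def)
qed

lemma smooth_on_Un:
  assumes "open S" "open T" "smooth_on S f" "smooth_on T f"
  shows "smooth_on (S \<union> T) f"
proof -
  have "Ck_on k f S \<Longrightarrow> Ck_on k f T \<Longrightarrow> Ck_on k f (S \<union> T)" for k
    using assms(1,2) by (induction k arbitrary: f) (auto intro: continuous_on_open_Un)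
  then show ?thesis using assms by (simp add: smooth_on_def)
qed

lemma partial_at_const [simp]: "partial_at i (\<lambda>x. c) = (\<lambda>x. 0)"
  by (rule ext, rule partial_at_eqI) (auto intro!: derivative_eq_intros)

lemma smooth_on_const: "smooth_on S (\<lambda>x. c)"
proof -
  have "Ck_on k (\<lambda>x. c) S" for k
    by (induction k arbitrary: c) auto
  then show ?thesis by (simp add: smooth_on_def)
qed

lemma hess_const [simp]: "hess (\<lambda>x. c) x = 0"
  by (simp add: hess_def vec_eq_iff)

lemma partial_at_add:
  assumes "f differentiable (at x)" "g differentiable (at x)"
  shows "partial_at i (\<lambda>x. f x + g x) x = partial_at i f x + partial_at i g x"
  unfolding partial_at_def[of i f] partial_at_def[of i g]
  by (rule partial_at_eqI[THEN trans])
     (use assms in \<open>auto intro!: has_derivative_add simp: frechet_derivative_works\<close>)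

lemma partial_at_mult:
  assumes "f differentiable (at x)" "g differentiable (at x)"
  shows "partial_at i (\<lambda>x. f x * g x) x = f x * partial_at i g x + partial_at i f x * g x"
  unfolding partial_at_def[of i f] partial_at_def[of i g]
  by (rule partial_at_eqI[THEN trans])
     (use assms in \<open>auto intro!: has_derivative_mult simp: frechet_derivative_works\<close>)

lemma partial_at_compose:
  assumes "f differentiable (at x)" "(h has_real_derivative d) (at (f x))"
  shows "partial_at i (\<lambda>x. h (f x)) x = d * partial_at i f x"
proof -
  have "(f has_derivative frechet_derivative f (at x)) (at x)"
    using assms(1) frechet_derivative_works by blast
  then have "((\<lambda>x. h (f x)) has_derivative (\<lambda>v. frechet_derivative f (at x) v * d)) (at x)"
    using DERIV_compose_FDERIV[of h d f x] assms(2) by blast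
  from partial_at_eqI[OF this] show ?thesis
    by (simp add: partial_at_def)
qed

lemma Ck_on_add:
  assumes "open S" shows "Ck_on k f S \<Longrightarrow> Ck_on k g S \<Longrightarrow> Ck_on k (\<lambda>x. f x + g x) S"
proof (induction k arbitrary: f g)
  case 0
  then show ?case by (auto intro: continuous_intros)
next
  case (Suc k)
  have "Ck_on k (partial_at i (\<lambda>x. f x + g x)) S" for i
    by (rule Ck_on_cong[OF assms _ Suc.IH[of "partial_at i f" "partial_at i g"]])
       (use Suc.prems in \<open>auto simp: partial_at_add\<close>)
  then show ?case using Suc.prems by auto
qed

lemma Ck_on_mult:
  assumes "open S" shows "Ck_on k f S \<Longrightarrow> Ck_on k g S \<Longrightarrow> Ck_on k (\<lambda>x. f x * g x) S"
proof (induction k arbitrary: f g)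
  case 0
  then show ?case by (auto intro: continuous_intros)
next
  case (Suc k)
  have "Ck_on k (partial_at i (\<lambda>x. f x * g x)) S" for i
  proof (rule Ck_on_cong[OF assms])
    show "Ck_on k (\<lambda>x. f x * partial_at i g x + partial_at i f x * g x) S"
      using Suc.prems Ck_on_SucD[OF Suc.prems(1)] Ck_on_SucD[OF Suc.prems(2)]
      by (intro Ck_on_add[OF assms] Suc.IH) auto
  qed (use Suc.prems in \<open>auto simp: partial_at_mult\<close>)
  then show ?case using Suc.prems by (auto intro: differentiable_mult)
qed

lemma smooth_on_add:
  "open S \<Longrightarrow> smooth_on S f \<Longrightarrow> smooth_on S g \<Longrightarrow> smooth_on S (\<lambda>x. f x + g x)"
  by (simp add: smooth_on_def Ck_on_add)

text \<open>
  A smooth function of one variable is presented by the sequence of its derivatives, so that the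
  chain rule turns into an induction over this sequence.
\<close>

lemma smooth_on_compose:
  fixes h :: "nat \<Rightarrow> real \<Rightarrow> real"
  assumes "open S" "smooth_on S f"
    and h: "\<And>k t. (h k has_real_derivative h (Suc k) t) (at t)"
  shows "smooth_on S (\<lambda>x. h m (f x))"
proof -
  have d: "f differentiable (at x)" if "x \<in> S" for x
    using smooth_on_differentiable[OF assms(2) that] .
  have hd: "(\<lambda>x. h m (f x)) differentiable (at x)" if "x \<in> S" for m x
    using DERIV_compose_FDERIV[of "h m" "h (Suc m) (f x)" f x] h d[OF that]
    unfolding differentiable_def by blast
  have "Ck_on k (\<lambda>x. h m (f x)) S" for k
  proof (induction k arbitrary: m)
    case 0
    have "continuous_on UNIV (h m)"
      using h by (meson DERIV_isCont continuous_at_imp_continuous_on)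
    then show ?case
      using continuous_on_compose2[of UNIV "h m" S f] smooth_on_imp_continuous_on[OF assms(2)]
      by auto
  next
    case (Suc k)
    have "Ck_on k (partial_at i (\<lambda>x. h m (f x))) S" for i
    proof (rule Ck_on_cong[OF assms(1)])
      show "Ck_on k (\<lambda>x. h (Suc m) (f x) * partial_at i f x) S"
        using assms(2) by (intro Ck_on_mult assms(1) Suc.IH)
          (metis smooth_on_def smooth_on_iff)
    qed (simp add: partial_at_compose[OF d h])
    then show ?case using hd by simp
  qed
  then show ?thesis by (simp add: smooth_on_def)
qed

lemma hess_add:
  assumes "open S" "smooth_on S f" "smooth_on S g" "x \<in> S"
  shows "hess (\<lambda>x. f x + g x) x = hess f x + hess g x"
proof -
  have d: "f differentiable (at y)" "g differentiable (at y)" if "y \<in> S" for y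
    using assms(2,3) that by (blast intro: smooth_on_differentiable)+
  have d2: "partial_at j f differentiable (at x)" "partial_at j g differentiable (at x)" for j
    using assms by (blast intro: smooth_on_differentiable smooth_on_partial_at)+
  have "partial_at i (\<lambda>x. partial_at j f x + partial_at j g x) x
      = partial_at i (partial_at j (\<lambda>x. f x + g x)) x" for i j
    by (rule partial_at_cong[OF _ assms(1,4)])
       (use d d2 in \<open>auto simp: partial_at_add intro!: differentiable_add\<close>)
  then show ?thesis
    using d2 by (simp add: hess_def vec_eq_iff flip: partial_at_add)
qed

definition outer :: "real^'n \<Rightarrow> real^'n^'n" where
  "outer g = (\<chi> i j. g $ i * g $ j)"

lemma hess_compose:
  fixes h :: "nat \<Rightarrow> real \<Rightarrow> real"
  assumes "open S" "smooth_on S f" "x \<in> S"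
    and h: "\<And>k t. (h k has_real_derivative h (Suc k) t) (at t)"
  shows "hess (\<lambda>x. h 0 (f x)) x
    = h 2 (f x) *\<^sub>R outer (grad f x) + h 1 (f x) *\<^sub>R hess f x"
proof -
  have d: "f differentiable (at y)" if "y \<in> S" for y
    using smooth_on_differentiable[OF assms(2) that] .
  have d2: "partial_at j f differentiable (at x)" for j
    using assms(2,3) by (blast intro: smooth_on_differentiable smooth_on_partial_at)
  have hd: "(\<lambda>x. h (Suc 0) (f x)) differentiable (at x)"
    by (rule smooth_on_differentiable[OF smooth_on_compose[OF assms(1,2)]]) (use assms in auto)
  have h1: "partial_at i (\<lambda>x. h (Suc 0) (f x)) x = h 2 (f x) * partial_at i f x" for i
    using partial_at_compose[OF d[OF assms(3)] h[of "Suc 0"]] by (simp add: numeral_2_eq_2)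
  have "partial_at i (partial_at j (\<lambda>x. h 0 (f x))) x
      = partial_at i (\<lambda>x. h (Suc 0) (f x) * partial_at j f x) x" for i j
    by (rule partial_at_cong[OF _ assms(1,3), symmetric])
       (use d2 hd in \<open>auto simp: partial_at_compose[OF d h] intro!: differentiable_mult\<close>)
  then show ?thesis
    using partial_at_mult[OF hd d2] h1
    by (simp add: hess_def vec_eq_iff outer_def grad_def algebra_simps)
qed

lemma partial_at_dist_sq: "partial_at i (\<lambda>x. c * ((x - a) \<bullet> (x - a))) = (\<lambda>x. 2 * c * (x - a) $ i)"
  by (rule ext, rule partial_at_eqI[THEN trans])
     (auto intro!: derivative_eq_intros simp: inner_axis inner_commute algebra_simps)

lemma partial_at_partial_at_dist_sq:
  "partial_at j (\<lambda>x. 2 * c * (x - a) $ i) = (\<lambda>x. if i = j then 2 * c else 0)"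
proof
  fix x
  have "((\<lambda>x. 2 * c * (x - a) $ i) has_derivative (\<lambda>v. 2 * c * v $ i)) (at x)"
    by (auto intro!: derivative_eq_intros bounded_linear.has_derivative[OF bounded_linear_vec_nth])
  from partial_at_eqI[OF this] show "partial_at j (\<lambda>x. 2 * c * (x - a) $ i) x = (if i = j then 2 * c else 0)"
    by (simp add: axis_def)
qed

lemma smooth_on_dist_sq: "smooth_on S (\<lambda>x. c * ((x - a) \<bullet> (x - a)))"
proof -
  have "(\<lambda>x. 2 * c * (x - a) $ i) differentiable (at x)" for x :: "real^'a" and i
    unfolding differentiable_def
    by (rule exI) (auto intro!: derivative_eq_intros
      bounded_linear.has_derivative[OF bounded_linear_vec_nth])
  then have "smooth_on S (\<lambda>x. 2 * c * (x - a) $ i)" for i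
    by (subst smooth_on_iff) (simp only: partial_at_partial_at_dist_sq smooth_on_const, simp)
  moreover have "(\<lambda>x. c * ((x - a) \<bullet> (x - a))) differentiable (at x)" for x :: "real^'a"
    unfolding differentiable_def
    by (rule exI) (auto intro!: derivative_eq_intros)
  ultimately show ?thesis
    by (subst smooth_on_iff) (simp only: partial_at_dist_sq, simp)
qed

lemma hess_dist_sq: "hess (\<lambda>x. c * ((x - a) \<bullet> (x - a))) x = (2 * c) *\<^sub>R mat 1"
  by (simp only: hess_def partial_at_dist_sq partial_at_partial_at_dist_sq)
     (simp add: vec_eq_iff mat_def)

lemma continuous_on_hess: "smooth_on S f \<Longrightarrow> continuous_on S (hess f)"
  unfolding hess_def
  by (intro continuous_on_vec_lambda smooth_on_imp_continuous_on smooth_on_partial_at)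

section \<open>Symmetry of the Hessian\<close>

lemma has_real_derivative_along_axis:
  assumes "f differentiable (at (p + s *\<^sub>R axis i 1))"
  shows "((\<lambda>s. f (p + s *\<^sub>R axis i 1)) has_real_derivative partial_at i f (p + s *\<^sub>R axis i 1)) (at s)"
proof -
  have *: "((\<lambda>s. p + s *\<^sub>R axis i 1) has_derivative (\<lambda>t. t *\<^sub>R axis i 1)) (at s)"
    by (auto intro!: derivative_eq_intros)
  have f: "(f has_derivative frechet_derivative f (at (p + s *\<^sub>R axis i 1))) (at (p + s *\<^sub>R axis i 1))"
    using assms frechet_derivative_works by blast
  have "(\<lambda>t. frechet_derivative f (at (p + s *\<^sub>R axis i 1)) (t *\<^sub>R axis i 1))
      = (*) (partial_at i f (p + s *\<^sub>R axis i 1))"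
    using linear_frechet_derivative[OF assms]
    by (auto simp: partial_at_def linear_cmul mult.commute)
  then show ?thesis
    using has_derivative_compose[OF * f] by (simp add: has_field_derivative_def)
qed

text \<open>
  The second difference of \<open>f\<close> over a small square is symmetric in the two directions, while two
  applications of the mean value theorem, one per direction, turn it into a value of an iterated
  partial derivative taken in a prescribed order. Clairaut's theorem follows by letting the square
  shrink.
\<close>

lemma second_difference_mean_value:
  assumes "smooth_on S f" "0 < t" "cball x (2 * t) \<subseteq> S"
  obtains y where "dist x y \<le> 2 * t"
    "f (x + t *\<^sub>R axis i 1 + t *\<^sub>R axis j 1) - f (x + t *\<^sub>R axis i 1) - f (x + t *\<^sub>R axis j 1) + f x
      = t\<^sup>2 * partial_at j (partial_at i f) y"
proof -
  let ?a = "axis i 1 :: real^'a" and ?b = "axis j 1 :: real^'a"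
  have near: "dist x (x + s *\<^sub>R ?a + r *\<^sub>R ?b) \<le> 2 * t"
    if "0 \<le> s" "s \<le> t" "0 \<le> r" "r \<le> t" for s r
  proof -
    have "norm (s *\<^sub>R ?a + r *\<^sub>R ?b) \<le> norm (s *\<^sub>R ?a) + norm (r *\<^sub>R ?b)"
      by (rule norm_triangle_ineq)
    also have "\<dots> \<le> 2 * t" using that by simp
    finally show ?thesis by (metis add.assoc add_diff_cancel_left' dist_commute dist_norm)
  qed
  then have mem: "x + s *\<^sub>R ?a + r *\<^sub>R ?b \<in> S"
    if "0 \<le> s" "s \<le> t" "0 \<le> r" "r \<le> t" for s r
    using that assms(3) by (meson mem_cball subsetD)
  have d: "f differentiable (at y)" "partial_at i f differentiable (at y)" if "y \<in> S" for y
    using assms(1) that by (blast intro: smooth_on_differentiable smooth_on_partial_at)+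
  let ?G = "\<lambda>s. f (x + t *\<^sub>R ?b + s *\<^sub>R ?a) - f (x + s *\<^sub>R ?a)"
  let ?G' = "\<lambda>s. partial_at i f (x + t *\<^sub>R ?b + s *\<^sub>R ?a) - partial_at i f (x + s *\<^sub>R ?a)"
  have "(?G has_real_derivative ?G' s) (at s)" if "0 \<le> s" "s \<le> t" for s
    using mem[of s t] mem[of s 0] that assms(2)
    by (intro DERIV_diff has_real_derivative_along_axis d) (simp_all add: add.commute add.left_commute)
  from MVT2[OF assms(2) this] obtain s where
    s: "0 < s" "s < t" "?G t - ?G 0 = t * ?G' s" by auto
  let ?L = "\<lambda>r. partial_at i f (x + s *\<^sub>R ?a + r *\<^sub>R ?b)"
  have "(?L has_real_derivative partial_at j (partial_at i f) (x + s *\<^sub>R ?a + r *\<^sub>R ?b)) (at r)"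
    if "0 \<le> r" "r \<le> t" for r
    using mem[of s r] that s by (intro has_real_derivative_along_axis d) auto
  from MVT2[OF assms(2) this] obtain r where
    r: "0 < r" "r < t" "?L t - ?L 0 = t * partial_at j (partial_at i f) (x + s *\<^sub>R ?a + r *\<^sub>R ?b)"
    by auto
  have "?G' s = ?L t - ?L 0" by (simp add: add.commute add.left_commute)
  then have "?G t - ?G 0 = t\<^sup>2 * partial_at j (partial_at i f) (x + s *\<^sub>R ?a + r *\<^sub>R ?b)"
    using s(3) r(3) by (simp add: power2_eq_square)
  moreover have "dist x (x + s *\<^sub>R ?a + r *\<^sub>R ?b) \<le> 2 * t"
    using s r by (intro near) auto
  ultimately show ?thesis
    using that by (simp add: add.commute add.left_commute algebra_simps)
qed

text \<open>
  The points produced by the mean value theorem for the two orders of differentiation differ, but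
  both tend to \<open>x\<close>, so continuity of the second partial derivatives identifies the limits.
\<close>

lemma hess_symmetric:
  assumes "open S" "smooth_on S f" "x \<in> S"
  shows "hess f x \<in> Sym2"
proof -
  have "partial_at i (partial_at j f) x = partial_at j (partial_at i f) x" for i j
  proof -
    obtain e where e: "e > 0" "ball x e \<subseteq> S"
      using assms(1,3) openE by blast
    \<comment> \<open>Side lengths for which the ball of radius \<open>2 * t n\<close> containing the square stays inside \<open>S\<close>.\<close>
    define t where "t n = e / (3 * real (Suc n))" for n
    have t: "0 < t n" for n
      using e by (simp add: t_def)
    have "2 * t n < e" for n
    proof -
      have "2 * e < e * (3 * real (Suc n))" using e by (auto simp: algebra_simps intro: add_pos_nonneg)
      then show ?thesis by (simp add: t_def field_simps)
    qed
    then have "cball x (2 * t n) \<subseteq> ball x e" for n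
      by (subst subset_eq) (metis le_less_trans mem_ball mem_cball)
    then have sub: "cball x (2 * t n) \<subseteq> S" for n
      using e(2) by blast
    have t0: "(\<lambda>n. 2 * t n) \<longlonglongrightarrow> 0"
      unfolding t_def using LIMSEQ_Suc[OF lim_const_over_n[of "2 * e / 3"]] by (simp add: field_simps)
    have "\<exists>y z. dist x y \<le> 2 * t n \<and> dist x z \<le> 2 * t n \<and>
        partial_at j (partial_at i f) y = partial_at i (partial_at j f) z" for n
    proof -
      obtain y where y: "dist x y \<le> 2 * t n"
        "f (x + t n *\<^sub>R axis i 1 + t n *\<^sub>R axis j 1) - f (x + t n *\<^sub>R axis i 1)
          - f (x + t n *\<^sub>R axis j 1) + f x = (t n)\<^sup>2 * partial_at j (partial_at i f) y"
        using second_difference_mean_value[OF assms(2) t sub] .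
      obtain z where z: "dist x z \<le> 2 * t n"
        "f (x + t n *\<^sub>R axis j 1 + t n *\<^sub>R axis i 1) - f (x + t n *\<^sub>R axis j 1)
          - f (x + t n *\<^sub>R axis i 1) + f x = (t n)\<^sup>2 * partial_at i (partial_at j f) z"
        using second_difference_mean_value[OF assms(2) t sub] .
      have "(t n)\<^sup>2 * partial_at j (partial_at i f) y = (t n)\<^sup>2 * partial_at i (partial_at j f) z"
        using y(2) z(2) by (simp add: algebra_simps)
      then show ?thesis using y z t[of n] by (intro exI[of _ y] exI[of _ z]) simp
    qed
    then obtain y z where yz: "\<And>n. dist x (y n) \<le> 2 * t n" "\<And>n. dist x (z n) \<le> 2 * t n"
      "\<And>n. partial_at j (partial_at i f) (y n) = partial_at i (partial_at j f) (z n)"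
      by metis
    have lim: "w \<longlonglongrightarrow> x" if "\<And>n. dist x (w n) \<le> 2 * t n" for w
      unfolding tendsto_dist_iff[of w]
      by (rule tendsto_sandwich[OF _ _ tendsto_const t0]) (use that in \<open>auto simp: dist_commute\<close>)
    have "isCont (partial_at k (partial_at l f)) x" for k l
      using assms(1,3) continuous_on_eq_continuous_at
        smooth_on_imp_continuous_on[OF smooth_on_partial_at[OF smooth_on_partial_at[OF assms(2)]]]
      by blast
    then have "(\<lambda>n. partial_at j (partial_at i f) (y n)) \<longlonglongrightarrow> partial_at j (partial_at i f) x"
      "(\<lambda>n. partial_at i (partial_at j f) (z n)) \<longlonglongrightarrow> partial_at i (partial_at j f) x"
      using lim[OF yz(1)] lim[OF yz(2)] isCont_tendsto_compose by blast+
    then show ?thesis using yz(3) LIMSEQ_unique by simp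
  qed
  then show ?thesis by (simp add: Sym2_def transpose_def hess_def vec_eq_iff)
qed

section \<open>A flat function\<close>

text \<open>
  The barriers are cut off by the flat function \<open>exp (- (1 / t))\<close>, extended by \<open>0\<close> to \<open>t \<le> 0\<close>. All its
  derivatives are polynomials in \<open>1 / t\<close> times the same exponential; carrying the polynomial as a
  parameter gives a family that is closed under differentiation.
\<close>

definition flat_fun :: "real poly \<Rightarrow> real \<Rightarrow> real" where
  "flat_fun p t = (if 0 < t then poly p (1 / t) * exp (- (1 / t)) else 0)"

definition flat_step :: "real poly \<Rightarrow> real poly" where
  "flat_step p = [:0, 0, 1:] * (p - pderiv p)"

lemma poly_div_exp_tendsto_0: "((\<lambda>x. poly p x * exp (- x)) \<longlongrightarrow> (0::real)) at_top"
proof -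
  have "((\<lambda>x. \<Sum>i\<le>degree p. coeff p i * (x ^ i / exp x)) \<longlongrightarrow> (\<Sum>i\<le>degree p. coeff p i * 0)) at_top"
    by (intro tendsto_sum tendsto_mult tendsto_const tendsto_power_div_exp_0)
  then show ?thesis
    by (simp add: poly_altdef exp_minus divide_inverse sum_distrib_right mult.assoc)
qed

text \<open>
  Away from \<open>0\<close> this is the chain rule. At \<open>0\<close> the difference quotient is \<open>q (1 / h) * exp (- (1 / h))\<close> for
  a polynomial \<open>q\<close>, and it vanishes in the limit because the exponential beats every polynomial.
\<close>

lemma flat_fun_has_derivative: "(flat_fun p has_real_derivative flat_fun (flat_step p) t) (at t)"
proof -
  consider "t > 0" | "t < 0" | "t = 0" by linarith
  then show ?thesis
  proof cases
    case 1
    have "((\<lambda>t. poly p (1 / t) * exp (- (1 / t))) has_real_derivative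
        flat_fun (flat_step p) t) (at t)"
      using 1 by (auto intro!: derivative_eq_intros DERIV_chain2[OF poly_DERIV]
          simp: flat_fun_def flat_step_def field_simps power2_eq_square)
    then show ?thesis
      by (rule DERIV_cong_ev[THEN iffD1, rotated -1, OF _ refl _ refl])
         (use 1 in \<open>auto simp: flat_fun_def eventually_nhds intro!: exI[of _ "{0<..}"]\<close>)
  next
    case 2
    have "((\<lambda>t. 0) has_real_derivative flat_fun (flat_step p) t) (at t)"
      using 2 by (simp add: flat_fun_def)
    then show ?thesis
      by (rule DERIV_cong_ev[THEN iffD1, rotated -1, OF _ refl _ refl])
         (use 2 in \<open>auto simp: flat_fun_def eventually_nhds intro!: exI[of _ "{..<0}"]\<close>)
  next
    case 3
    have "((\<lambda>h. flat_fun p h / h) \<longlongrightarrow> 0) (at_right 0)"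
    proof -
      have "((\<lambda>h. poly ([:0, 1:] * p) (inverse h) * exp (- inverse h)) \<longlongrightarrow> 0) (at_right 0)"
        by (rule filterlim_compose[OF poly_div_exp_tendsto_0 filterlim_inverse_at_top_right])
      moreover have "\<forall>\<^sub>F h in at_right 0. poly ([:0, 1:] * p) (inverse h) * exp (- inverse h)
          = flat_fun p h / h"
        by (auto simp: eventually_at_filter flat_fun_def field_simps)
      ultimately show ?thesis by (rule Lim_transform_eventually)
    qed
    moreover have "((\<lambda>h. flat_fun p h / h) \<longlongrightarrow> 0) (at_left 0)"
      by (rule Lim_transform_eventually[OF tendsto_const])
         (auto simp: eventually_at_filter flat_fun_def)
    ultimately have "((\<lambda>h. flat_fun p h / h) \<longlongrightarrow> 0) (at 0)"
      by (simp add: filterlim_split_at)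
    then show ?thesis using 3 by (simp add: DERIV_def flat_fun_def)
  qed
qed

lemma flat_step_1: "flat_step 1 = [:0, 0, 1:]"
  by (simp add: flat_step_def pderiv_1)

lemma flat_fun_first_nonneg: "0 \<le> flat_fun (flat_step 1) t"
  by (simp add: flat_step_1 flat_fun_def)

text \<open>
  The second derivative is \<open>s ^ 3 * (s - 2) * exp (- s)\<close> with \<open>s = 1 / t\<close>; hence the flat function is
  convex only up to \<open>t = 1/2\<close>, and the barriers are kept below this value.
\<close>

lemma flat_fun_second_nonneg:
  assumes "t \<le> 1/2" shows "0 \<le> flat_fun (flat_step (flat_step 1)) t"
proof -
  have "0 \<le> (1/t)^3 * (1/t - 2)" if "0 < t"
    using assms that by (simp add: field_simps)
  moreover have "poly (flat_step (flat_step 1)) s = s^3 * (s - 2)" for s :: real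
    by (simp add: flat_step_1) (simp add: flat_step_def pderiv_pCons power3_eq_cube algebra_simps)
  ultimately show ?thesis
    by (simp add: flat_fun_def)
qed

section \<open>Duality for cones of quadratic forms\<close>

lemma sym_ip_eq_inner: "B \<in> Sym2 \<Longrightarrow> sym_ip A B = A \<bullet> B"
  by (auto simp: sym_ip_def trace_def matrix_matrix_mult_def inner_vec_def Sym2_def transpose_def
      vec_eq_iff intro!: sum.cong)

lemma inner_outer: "A \<bullet> outer g = g \<bullet> (A *v g)"
  by (simp add: inner_vec_def outer_def matrix_vector_mult_def sum_distrib_left algebra_simps)

lemma inner_transpose: "transpose A \<bullet> B = A \<bullet> transpose B"
  unfolding inner_vec_def transpose_def by simp (rule sum.swap)

text \<open>
  The bipolar theorem inside \<open>Sym2\<close>. Separating \<open>B\<close> from \<open>P\<close> by a hyperplane gives a matrix \<open>a\<close> that need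
  not be symmetric; its symmetrization pairs with symmetric matrices like \<open>2 * a\<close> and so is a
  witness in the polar cone.
\<close>

lemma mem_cone_if_polar_nonneg:
  assumes P: "P \<subseteq> Sym2" "closed P" "convex P" "cone P" "P \<noteq> {}"
    and B: "B \<in> Sym2" "\<And>A. A \<in> polar_cone P \<Longrightarrow> 0 \<le> A \<bullet> B"
  shows "B \<in> P"
proof (rule ccontr)
  assume "B \<notin> P"
  then obtain a b where ab: "a \<bullet> B < b" "\<And>x. x \<in> P \<Longrightarrow> b < a \<bullet> x"
    using separating_hyperplane_closed_point[OF P(3,2)] by blast
  have "0 \<in> P" using P cone_contains_0 by blast
  then have b: "b < 0" using ab(2) by fastforce
  have a: "0 \<le> a \<bullet> X" if "X \<in> P" for X
  proof (rule ccontr)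
    assume neg: "\<not> 0 \<le> a \<bullet> X"
    \<comment> \<open>The multiple of \<open>X\<close> on which \<open>a\<close> takes the excluded value \<open>b\<close>.\<close>
    have "(b / (a \<bullet> X)) *\<^sub>R X \<in> P"
      using P(4) that neg b by (auto simp: cone_def divide_nonpos_neg)
    from ab(2)[OF this] show False using neg by simp
  qed
  let ?A = "a + transpose a"
  have sym: "?A \<bullet> X = 2 * (a \<bullet> X)" if "X \<in> Sym2" for X
    using that by (simp add: inner_add_left inner_transpose Sym2_def)
  have S: "?A \<in> Sym2"
    by (simp add: Sym2_def transpose_def vec_eq_iff)
  have "0 \<le> sym_ip ?A X" if "X \<in> P" for X
    using a[OF that] sym[of X] that P(1) by (auto simp: sym_ip_eq_inner)
  then have "?A \<in> polar_cone P"
    using S by (simp add: polar_cone_def)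
  from B(2)[OF this] sym[OF B(1)] b ab(1) show False by simp
qed

text \<open>
  Were \<open>P\<close> empty, its polar would consist of all symmetric matrices, including \<open>- mat 1\<close>.
\<close>

lemma positivity_condition_nonempty:
  fixes P :: "(real^'n::finite^'n) set"
  assumes "positivity_condition P" shows "P \<noteq> {}"
proof
  assume "P = {}"
  moreover have "- mat 1 \<in> (Sym2 :: (real^'n^'n) set)"
    by (auto simp: Sym2_def transpose_def mat_def vec_eq_iff)
  ultimately have "nonneg_form (- mat 1 :: real^'n^'n)"
    using assms by (auto simp: positivity_condition_def polar_cone_def)
  then have "0 \<le> v \<bullet> ((- mat 1) *v v)" for v :: "real^'n"
    by (simp add: nonneg_form_def)
  moreover have "(- mat 1) *v v = - v" for v :: "real^'n"
    by (metis matrix_vector_mul_lid matrix_vector_mult_diff_rdistrib matrix_vector_mult_0 diff_0)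
  ultimately have "0 \<le> v \<bullet> (- v)" for v :: "real^'n" by metis
  from this[of "axis undefined 1"] show False by simp
qed

lemma closed_polar_cone:
  assumes "P \<subseteq> Sym2" shows "closed (polar_cone P)"
proof -
  have "polar_cone P = (\<Inter>i. \<Inter>j. {A. A $ i $ j = A $ j $ i}) \<inter> (\<Inter>B\<in>P. {A. 0 \<le> A \<bullet> B})"
    using assms by (auto simp: polar_cone_def Sym2_def transpose_def vec_eq_iff sym_ip_eq_inner subset_eq)
  then show ?thesis
    by (auto intro!: closed_INT closed_Int closed_Collect_eq closed_Collect_le continuous_intros)
qed

text \<open>
  A nonnegative form is minimal at an isotropic vector \<open>g\<close>, so its derivative there, \<open>2 * A *v g\<close>, is zero.
  A small step from \<open>g\<close> in the direction \<open>- (A *v g)\<close> would otherwise make the form negative.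
\<close>

lemma nonneg_form_isotropic:
  assumes A: "nonneg_form A" and g: "g \<bullet> (A *v g) = 0"
  shows "A *v g = 0"
proof (rule ccontr)
  assume ne: "A *v g \<noteq> 0"
  define v where "v = A *v g"
  define q where "q = v \<bullet> (A *v v)"
  \<comment> \<open>Any step with \<open>s * q < 2 * (v \<bullet> v)\<close> contradicts nonnegativity; the \<open>1\<close> guards against \<open>q = 0\<close>.\<close>
  define s where "s = (v \<bullet> v) / (1 + q)"
  have q: "0 \<le> q" using A by (simp add: q_def nonneg_form_def)
  have v: "0 < v \<bullet> v" using ne by (simp add: v_def)
  have s: "0 < s" using q v by (simp add: s_def)
  have "g \<bullet> (A *v v) = v \<bullet> v"
    using A dot_lmul_matrix[of g A v] transpose_matrix_vector[of A g]
    by (simp add: nonneg_form_def Sym2_def v_def)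
  then have "(g - s *\<^sub>R v) \<bullet> (A *v (g - s *\<^sub>R v)) = s * (s * q - 2 * (v \<bullet> v))"
    using g by (simp add: matrix_vector_mult_diff_distrib matrix_vector_mult_scaleR inner_diff_left
        inner_diff_right q_def algebra_simps flip: v_def)
  moreover have "0 \<le> (g - s *\<^sub>R v) \<bullet> (A *v (g - s *\<^sub>R v))"
    using A unfolding nonneg_form_def by blast
  ultimately have "0 \<le> s * q - 2 * (v \<bullet> v)"
    using s by (simp add: zero_le_mult_iff)
  moreover have "s * q \<le> v \<bullet> v"
    using q v by (simp add: s_def field_simps)
  ultimately show False using v by simp
qed

text \<open>
  The orthogonal complement of the hyperplane \<open>{v. g \<bullet> v = 0}\<close> is spanned by \<open>g\<close>, so a form is tangential
  to the hyperplane as soon as it annihilates \<open>g\<close>.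
\<close>

lemma isotropic_imp_tangential:
  assumes A: "nonneg_form A" and g: "g \<bullet> (A *v g) = 0"
  shows "A \<in> Sym2_of {v. g \<bullet> v = 0}"
proof -
  have "A *v w = 0" if w: "w \<in> orthogonal_comp {v. g \<bullet> v = 0}" for w
  proof -
    define k where "k = (w \<bullet> g) / (g \<bullet> g)"
    define y where "y = w - k *\<^sub>R g"
    have gy: "g \<bullet> y = 0"
      by (simp add: y_def k_def inner_diff_right inner_commute)
    have "y \<bullet> w = 0"
      using w gy by (auto simp: orthogonal_comp_def orthogonal_def)
    then have "y \<bullet> y = 0"
      using gy by (simp add: y_def inner_diff_right inner_commute)
    then have "w = k *\<^sub>R g" by (simp add: y_def)
    then show ?thesis
      using nonneg_form_isotropic[OF assms] by (simp add: matrix_vector_mult_scaleR)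
  qed
  then show ?thesis using A by (simp add: Sym2_of_def nonneg_form_def)
qed

text \<open>
  On the compact part of \<open>T\<close> where \<open>f\<close> is not positive, \<open>q\<close> is bounded below by a positive constant, so a
  large multiple of \<open>q\<close> outweighs the minimum of \<open>f\<close>; elsewhere \<open>f\<close> is positive by itself.
\<close>

lemma compact_penalty:
  fixes f q :: "'a::metric_space \<Rightarrow> real"
  assumes T: "compact T" "continuous_on T f" "continuous_on T q"
    and q: "\<And>x. x \<in> T \<Longrightarrow> 0 \<le> q x"
    and fq: "\<And>x. x \<in> T \<Longrightarrow> f x \<le> 0 \<Longrightarrow> 0 < q x"
  obtains l \<mu> where "0 < l" "0 < \<mu>" "\<And>x. x \<in> T \<Longrightarrow> \<mu> \<le> f x + l * q x"
proof -
  define T0 where "T0 = {x \<in> T. f x \<le> 0}"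
  have T0: "compact T0"
  proof -
    have "closedin (top_of_set T) (T \<inter> f -` {..0})"
      using T(2) continuous_closedin_preimage by blast
    moreover have "T \<inter> f -` {..0} = T0" by (auto simp: T0_def)
    ultimately show ?thesis using T(1) closedin_compact by metis
  qed
  have "\<exists>l>0. \<forall>x\<in>T. 0 < f x + l * q x"
  proof (cases "T0 = {}")
    case True
    then have "0 < f x + 1 * q x" if "x \<in> T" for x
      using that q[OF that] by (fastforce simp: T0_def)
    then show ?thesis by (intro exI[of _ 1]) auto
  next
    case False
    have "continuous_on T0 f" "continuous_on T0 q"
      using T(2,3) by (auto simp: T0_def intro: continuous_on_subset)
    then obtain a b where a: "a \<in> T0" "\<And>x. x \<in> T0 \<Longrightarrow> f a \<le> f x"
      and b: "b \<in> T0" "\<And>x. x \<in> T0 \<Longrightarrow> q b \<le> q x"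
      using continuous_attains_inf[OF T0 False] by metis
    define l where "l = (1 - f a) / q b"
    have qb: "0 < q b" and fa: "f a \<le> 0" using a b fq by (auto simp: T0_def)
    have l: "0 < l" using qb fa by (simp add: l_def)
    have "0 < f x + l * q x" if "x \<in> T" for x
    proof (cases "x \<in> T0")
      case True
      have "l * q b \<le> l * q x" using b(2)[OF True] l by simp
      moreover have "l * q b = 1 - f a" using qb by (simp add: l_def)
      ultimately show ?thesis using a(2)[OF True] by simp
    next
      case False
      then have "0 < f x" using that by (auto simp: T0_def)
      moreover have "0 \<le> l * q x" using l q[OF that] by simp
      ultimately show ?thesis by simp
    qed
    then show ?thesis using l by blast
  qed
  then obtain l where l: "0 < l" "\<And>x. x \<in> T \<Longrightarrow> 0 < f x + l * q x" by blast
  show ?thesis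
  proof (cases "T = {}")
    case True
    then show ?thesis using that[of 1 1] by simp
  next
    case False
    have "continuous_on T (\<lambda>x. f x + l * q x)" using T by (intro continuous_intros)
    from continuous_attains_inf[OF T(1) False this] obtain a where
      "a \<in> T" "\<And>x. x \<in> T \<Longrightarrow> f a + l * q a \<le> f x + l * q x" by blast
    then show ?thesis using that[OF l(1) l(2)] by blast
  qed
qed

text \<open>
  Strict convexity only controls the tangential part of \<open>H\<close>. A nonnegative \<open>A\<close> with \<open>A \<bullet> outer g = 0\<close> is
  tangential, so on the unit sphere of the polar cone the quantity \<open>A \<bullet> outer g\<close> is positive wherever
  \<open>A \<bullet> H\<close> is not, and a large multiple of \<open>outer g\<close> moves \<open>H\<close> into the interior of \<open>P\<close> relative
  to \<open>Sym2\<close>. By duality every symmetric matrix within distance \<open>\<mu>\<close> of the result is still in \<open>P\<close>.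
\<close>

lemma polar_cone_margin:
  fixes P :: "(real^'n::finite^'n) set"
  assumes "P \<subseteq> Sym2" "positivity_condition P"
    and H: "\<And>A. A \<in> polar_cone P \<Longrightarrow> A \<in> Sym2_of {v. g \<bullet> v = 0} \<Longrightarrow> A \<noteq> 0 \<Longrightarrow> 0 < sym_ip H A"
  obtains l \<mu> where "0 < l" "0 < \<mu>"
    "\<And>A. A \<in> polar_cone P \<Longrightarrow> \<mu> * norm A \<le> A \<bullet> H + l * (A \<bullet> outer g)"
proof -
  let ?T = "polar_cone P \<inter> sphere 0 1"
  have T: "compact ?T"
    by (rule closed_Int_compact[OF closed_polar_cone[OF assms(1)] compact_sphere])
  have nn: "nonneg_form A" if "A \<in> polar_cone P" for A
    using that assms(2) by (simp add: positivity_condition_def)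
  have 1: "0 \<le> A \<bullet> outer g" if "A \<in> ?T" for A
    using nn that by (auto simp: inner_outer nonneg_form_def)
  have 2: "0 < A \<bullet> outer g" if A: "A \<in> ?T" "A \<bullet> H \<le> 0" for A
  proof (rule ccontr)
    assume "\<not> 0 < A \<bullet> outer g"
    then have "g \<bullet> (A *v g) = 0" using 1[OF A(1)] by (simp add: inner_outer)
    then have "A \<in> Sym2_of {v. g \<bullet> v = 0}"
      using isotropic_imp_tangential nn A(1) by blast
    then have "0 < sym_ip H A" using A(1) by (intro H) auto
    moreover have "A \<in> Sym2" using A by (simp add: polar_cone_def)
    ultimately show False using A(2) by (simp add: sym_ip_eq_inner inner_commute)
  qed
  obtain l \<mu> where l: "0 < l" "0 < \<mu>" "\<And>A. A \<in> ?T \<Longrightarrow> \<mu> \<le> A \<bullet> H + l * (A \<bullet> outer g)"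
    by (rule compact_penalty[OF T, of "\<lambda>A. A \<bullet> H" "\<lambda>A. A \<bullet> outer g"])
       (use 1 2 in \<open>auto intro!: continuous_intros\<close>)
  have "\<mu> * norm A \<le> A \<bullet> H + l * (A \<bullet> outer g)" if A: "A \<in> polar_cone P" for A
  proof (cases "A = 0")
    case False
    define B where "B = (1 / norm A) *\<^sub>R A"
    have "B \<in> polar_cone P"
      using A assms(1)
      by (auto simp: polar_cone_def B_def Sym2_def transpose_def vec_eq_iff sym_ip_eq_inner subset_eq)
    then have "B \<in> ?T" using False by (simp add: B_def)
    from l(3)[OF this] have "\<mu> \<le> (A \<bullet> H + l * (A \<bullet> outer g)) / norm A"
      by (simp add: B_def add_divide_distrib)
    then show ?thesis using False by (simp add: field_simps)
  qed simp
  then show ?thesis using that l by blast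
qed

section \<open>Barriers at the boundary\<close>

text \<open>
  A frontier point of the open set \<open>\<Omega>\<close> lies outside \<open>\<Omega>\<close>, which forces \<open>0 \<le> \<rho> x\<close>, and is a limit of points
  of \<open>\<Omega>\<close>, which forces the opposite inequality.
\<close>

lemma defining_function_zero_on_frontier:
  assumes "open \<Omega>" "defining_function \<Omega> U \<rho>" "x \<in> frontier \<Omega>"
  shows "\<rho> x = 0"
proof -
  have U: "open U" "x \<in> U" "smooth_on U \<rho>" "\<Omega> \<inter> U = {x \<in> U. \<rho> x < 0}"
    using assms by (auto simp: defining_function_def)
  have cont: "isCont \<rho> x"
    using U smooth_on_imp_continuous_on continuous_on_eq_continuous_at by blast
  have "x \<notin> \<Omega>" using assms by (auto simp: frontier_def interior_open)
  then have "0 \<le> \<rho> x" using U by force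
  have "x \<in> closure \<Omega>" using assms by (auto simp: frontier_def)
  then obtain s where s: "\<And>n. s n \<in> \<Omega>" "s \<longlonglongrightarrow> x"
    using closure_sequential by blast
  have "\<forall>\<^sub>F n in sequentially. s n \<in> U"
    using topological_tendstoD[OF s(2) U(1,2)] .
  then have "\<forall>\<^sub>F n in sequentially. \<rho> (s n) \<le> 0"
    by (rule eventually_mono) (use s(1) U(4) in force)
  then have "\<rho> x \<le> 0"
    using tendsto_upperbound[OF isCont_tendsto_compose[OF cont s(2)]] by simp
  with \<open>0 \<le> \<rho> x\<close> show ?thesis by simp
qed

text \<open>
  Near \<open>x0\<close> the function \<open>\<phi> = (exp (l * \<rho>) - 1) / l - c * (dist x0 x)\<^sup>2\<close> has its Hessian in \<open>P\<close> for suitable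
  \<open>l\<close> and \<open>c\<close>: the exponential contributes \<open>l * outer (grad \<rho>)\<close>, and \<open>c\<close> is small compared with the margin
  gained in this way. Since \<open>\<rho>\<close> is negative in \<open>\<Omega>\<close>, the part of \<open>\<Omega>\<close> where \<open>\<phi> > - \<epsilon>\<close> is confined to
  \<open>c * (dist x0 x)\<^sup>2 < \<epsilon>\<close>. Therefore the flat function of \<open>\<phi> + \<epsilon>\<close>, which is
  increasing and convex in the relevant range and so keeps the Hessian in \<open>P\<close>, extends by zero to all
  of \<open>\<Omega>\<close>.
\<close>

lemma boundary_barrier:
  fixes P :: "(real^'n::finite^'n) set"
  assumes P: "P \<subseteq> Sym2" "closed P" "convex P" "cone P" "positivity_condition P"
    and \<Omega>: "open \<Omega>" "x0 \<in> frontier \<Omega>" "strictly_convex_at P \<Omega> x0" and "0 < r"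
  obtains u e where "u \<in> PSH P \<Omega>" "0 < e"
    "\<And>x. x \<in> \<Omega> \<Longrightarrow> r \<le> dist x0 x \<Longrightarrow> u x = 0"
    "\<And>x. x \<in> \<Omega> \<Longrightarrow> dist x0 x < e \<Longrightarrow> 0 < u x"
proof -
  have P0: "P \<noteq> {}" using positivity_condition_nonempty[OF P(5)] .
  obtain U \<rho> where df: "defining_function \<Omega> U \<rho>"
    and sc: "\<And>A. A \<in> polar_cone P \<Longrightarrow> A \<in> Sym2_of (tangent_space \<rho> x0) \<Longrightarrow> A \<noteq> 0 \<Longrightarrow>
          0 < sym_ip (hess \<rho> x0) A"
    using \<Omega>(3) unfolding strictly_convex_at_def by blast
  have U: "open U" "x0 \<in> U" "smooth_on U \<rho>" "\<Omega> \<inter> U = {x \<in> U. \<rho> x < 0}"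
    using df \<Omega>(2) by (auto simp: defining_function_def)
  have \<rho>0: "\<rho> x0 = 0" using defining_function_zero_on_frontier[OF \<Omega>(1) df \<Omega>(2)] .
  have pos: "0 \<le> A \<bullet> outer v" if "A \<in> polar_cone P" for A v
    using that P(5) by (simp add: inner_outer positivity_condition_def nonneg_form_def)
  obtain l \<mu> where l: "0 < l" and \<mu>: "0 < \<mu>"
    and margin: "\<And>A. A \<in> polar_cone P \<Longrightarrow>
      \<mu> * norm A \<le> A \<bullet> hess \<rho> x0 + l * (A \<bullet> outer (grad \<rho> x0))"
    by (rule polar_cone_margin[OF P(1,5) sc[unfolded tangent_space_def]]) (assumption | rule that)+

  \<comment> \<open>The derivatives of \<open>(exp (l * t) - 1) / l\<close>, a function with value \<open>0\<close>, slope \<open>1\<close> and second derivative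
    \<open>l\<close> at \<open>0\<close>.\<close>
  define E where "E k t = (if k = 0 then (exp (l * t) - 1) / l else l ^ (k - 1) * exp (l * t))"
    for k :: nat and t :: real
  have E: "(E k has_real_derivative E (Suc k) t) (at t)" for k t
    using l by (cases k) (auto simp: E_def[abs_def] intro!: derivative_eq_intros)
  define I where "I = (mat 1 :: real^'n^'n)"
  have I: "0 < norm I"
    by (simp add: I_def mat_def vec_eq_iff)
  \<comment> \<open>Subtracting \<open>c * (dist x0 x)\<^sup>2\<close> costs \<open>2 * c * norm I = \<mu> / 2\<close>, half of the margin; the other half
    pays for the variation of the Hessian near \<open>x0\<close>.\<close>
  define c where "c = \<mu> / (4 * norm I)"
  have c: "0 < c" using I \<mu> by (simp add: c_def)
  define \<phi> where "\<phi> x = E 0 (\<rho> x) + (- c) * ((x - x0) \<bullet> (x - x0))" for x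
  have sm: "smooth_on U (\<lambda>x. E 0 (\<rho> x))"
    using smooth_on_compose[of U \<rho> E 0, OF U(1,3) E] .
  have sm\<phi>: "smooth_on U \<phi>"
    unfolding \<phi>_def by (rule smooth_on_add[OF U(1) sm smooth_on_dist_sq])
  have "hess \<phi> x0 = hess (\<lambda>x. E 0 (\<rho> x)) x0 + (2 * (- c)) *\<^sub>R I"
    using hess_add[OF U(1) sm smooth_on_dist_sq U(2), of "- c" x0]
    by (simp only: \<phi>_def[abs_def] hess_dist_sq I_def)
  also have "hess (\<lambda>x. E 0 (\<rho> x)) x0 = l *\<^sub>R outer (grad \<rho> x0) + hess \<rho> x0"
    using hess_compose[of U \<rho> x0 E, OF U(1,3,2) E] by (simp add: \<rho>0 E_def)
  finally have hess0: "hess \<phi> x0 = l *\<^sub>R outer (grad \<rho> x0) + hess \<rho> x0 + (2 * (- c)) *\<^sub>R I" .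
  have at0: "\<mu> / 2 * norm A \<le> A \<bullet> hess \<phi> x0" if A: "A \<in> polar_cone P" for A
  proof -
    have "A \<bullet> hess \<phi> x0 = A \<bullet> hess \<rho> x0 + l * (A \<bullet> outer (grad \<rho> x0)) - 2 * c * (A \<bullet> I)"
      by (simp add: hess0 inner_add_right inner_diff_right)
    moreover have "2 * c * (A \<bullet> I) \<le> 2 * c * (norm A * norm I)"
      using c norm_cauchy_schwarz[of A I] by simp
    moreover have "2 * c * (norm A * norm I) = \<mu> / 2 * norm A"
      using I by (simp add: c_def)
    moreover have "\<mu> / 2 * norm A = \<mu> * norm A / 2" by simp
    ultimately show ?thesis using margin[OF A] by linarith
  qed
  have "isCont (hess \<phi>) x0"
    using continuous_on_hess[OF sm\<phi>] U continuous_on_eq_continuous_at by blast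
  then obtain d where d: "0 < d" "\<And>x. dist x x0 < d \<Longrightarrow> dist (hess \<phi> x) (hess \<phi> x0) < \<mu> / 2"
    using \<mu> unfolding continuous_at_eps_delta by (metis half_gt_zero)
  obtain d' where d': "0 < d'" "ball x0 d' \<subseteq> U" using U openE by blast
  define r1 where "r1 = min r (min d d')"
  have r1: "0 < r1" "r1 \<le> r" "ball x0 r1 \<subseteq> U"
    using d(1) d' assms by (auto simp: r1_def)
  have near: "0 \<le> A \<bullet> hess \<phi> x" if A: "A \<in> polar_cone P" and x: "x \<in> ball x0 r1" for A x
  proof -
    have "norm (hess \<phi> x - hess \<phi> x0) \<le> \<mu> / 2"
      using d(2)[of x] x by (simp add: r1_def dist_norm norm_minus_commute)
    then have "norm A * norm (hess \<phi> x - hess \<phi> x0) \<le> norm A * (\<mu> / 2)"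
      by (rule mult_left_mono) simp
    then have "\<bar>A \<bullet> (hess \<phi> x - hess \<phi> x0)\<bar> \<le> norm A * (\<mu> / 2)"
      using Cauchy_Schwarz_ineq2 order_trans by blast
    moreover have "A \<bullet> (hess \<phi> x - hess \<phi> x0) = A \<bullet> hess \<phi> x - A \<bullet> hess \<phi> x0"
      by (rule inner_diff_right)
    ultimately show ?thesis using at0[OF A] mult.commute[of "norm A" "\<mu> / 2"] by linarith
  qed

  \<comment> \<open>The bound \<open>1/2\<close> stays in the convex range of the flat function, and the other bound confines the
    support to \<open>cball x0 (r1 / 2)\<close>.\<close>
  define \<epsilon> where "\<epsilon> = min (1/2) (c * (r1 / 2)\<^sup>2)"
  have \<epsilon>: "0 < \<epsilon>" "\<epsilon> \<le> 1/2" "\<epsilon> \<le> c * (r1 / 2)\<^sup>2"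
    using c r1 by (auto simp: \<epsilon>_def)
  define \<psi> where "\<psi> x = \<phi> x + \<epsilon>" for x
  have sm\<psi>: "smooth_on U \<psi>"
    unfolding \<psi>_def by (rule smooth_on_add[OF U(1) sm\<phi> smooth_on_const])
  have hess\<psi>: "hess \<psi> x = hess \<phi> x" if "x \<in> U" for x
    using hess_add[OF U(1) sm\<phi> smooth_on_const that, of \<epsilon>] by (simp add: \<psi>_def[abs_def])
  have \<psi>_le: "\<psi> x \<le> \<epsilon> - c * (dist x0 x)\<^sup>2" if "x \<in> \<Omega>" "x \<in> ball x0 r1" for x
  proof -
    have "\<rho> x < 0" using that r1 U by blast
    then have "E 0 (\<rho> x) \<le> 0"
      using l by (simp add: E_def divide_le_0_iff mult_le_0_iff)
    then show ?thesis
      by (simp add: \<psi>_def \<phi>_def dist_norm norm_minus_commute flip: power2_norm_eq_inner)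
  qed

  define F where "F k = flat_fun ((flat_step ^^ k) 1)" for k
  have F: "(F k has_real_derivative F (Suc k) t) (at t)" for k t
    unfolding F_def funpow.simps o_def by (rule flat_fun_has_derivative)
  have F0: "F 0 t = 0" if "t \<le> 0" for t using that by (simp add: F_def flat_fun_def)
  have F0': "0 < F 0 t" if "0 < t" for t using that by (simp add: F_def flat_fun_def)
  have F1: "0 \<le> F 1 t" for t by (simp add: F_def flat_fun_first_nonneg)
  have F2: "0 \<le> F 2 t" if "t \<le> 1/2" for t
    using that by (simp add: F_def numeral_2_eq_2 flat_fun_second_nonneg)
  define u where "u x = (if x \<in> ball x0 r1 then F 0 (\<psi> x) else 0)" for x
  define S where "S = \<Omega> \<inter> ball x0 r1"
  define T where "T = \<Omega> - cball x0 (r1 / 2)"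
  have ST: "open S" "open T" "S \<union> T = \<Omega>"
    using \<Omega>(1) r1(1) by (auto simp: S_def T_def)
  have S: "smooth_on S \<psi>" "\<And>x. x \<in> S \<Longrightarrow> F 0 (\<psi> x) = u x"
    using smooth_on_subset[OF sm\<psi>, of S] r1 by (auto simp: S_def u_def)
  have T: "0 = u x" if "x \<in> T" for x
  proof (cases "x \<in> ball x0 r1")
    case True
    have x: "x \<in> \<Omega>" "r1 / 2 \<le> dist x0 x" using that by (auto simp: T_def)
    have "c * (r1 / 2)\<^sup>2 \<le> c * (dist x0 x)\<^sup>2"
      using x(2) c r1(1) by (intro mult_left_mono power_mono) auto
    then have "\<psi> x \<le> 0" using \<psi>_le[OF x(1) True] \<epsilon>(3) by simp
    then show ?thesis using F0 by (simp add: u_def)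
  qed (simp add: u_def)
  have smS: "smooth_on S (\<lambda>x. F 0 (\<psi> x))"
    using smooth_on_compose[of S \<psi> F 0, OF ST(1) S(1) F] .
  have "smooth_on S u"
    by (rule smooth_on_cong[OF ST(1) _ smS]) (rule S(2))
  moreover have "smooth_on T u"
    by (rule smooth_on_cong[OF ST(2) _ smooth_on_const]) (rule T)
  ultimately have smu: "smooth_on \<Omega> u"
    using smooth_on_Un[OF ST(1,2)] ST(3) by simp
  have "hess u x \<in> P" if x: "x \<in> \<Omega>" for x
  proof (rule mem_cone_if_polar_nonneg[OF P(1-4) P0 hess_symmetric[OF \<Omega>(1) smu x]])
    fix A assume A: "A \<in> polar_cone P"
    show "0 \<le> A \<bullet> hess u x"
    \<comment> \<open>Outside the support the Hessian is zero; inside, the chain rule writes it as a combination, with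
      nonnegative coefficients, of a rank one form and the Hessian of \<open>\<phi>\<close>.\<close>
    proof (cases "x \<in> T")
      case True
      have "hess (\<lambda>x. 0) x = hess u x"
        by (rule hess_cong[OF smooth_on_const ST(2) True]) (rule T)
      then show ?thesis by simp
    next
      case False
      then have xS: "x \<in> S" using x ST by blast
      then have xb: "x \<in> ball x0 r1" by (simp add: S_def)
      have "hess u x = hess (\<lambda>x. F 0 (\<psi> x)) x"
        by (rule hess_cong[OF smS ST(1) xS, symmetric]) (rule S(2))
      also have "\<dots> = F 2 (\<psi> x) *\<^sub>R outer (grad \<psi> x) + F 1 (\<psi> x) *\<^sub>R hess \<psi> x"
        using hess_compose[of S \<psi> x F, OF ST(1) S(1) xS F] .
      finally have "A \<bullet> hess u x
          = F 2 (\<psi> x) * (A \<bullet> outer (grad \<psi> x)) + F 1 (\<psi> x) * (A \<bullet> hess \<phi> x)"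
        using hess\<psi> xb r1(3) by (auto simp: inner_add_right)
      moreover have "\<psi> x \<le> 1/2"
        using \<psi>_le[OF x xb] \<epsilon>(2) c by (smt (verit) mult_nonneg_nonneg zero_le_power2)
      ultimately show ?thesis
        using F1 F2 pos[OF A] near[OF A xb] by simp
    qed
  qed
  then have 1: "u \<in> PSH P \<Omega>" using smu by (simp add: PSH_def)
  have "isCont \<psi> x0"
    using smooth_on_imp_continuous_on[OF sm\<psi>] U continuous_on_eq_continuous_at by blast
  moreover have "\<psi> x0 = \<epsilon>" by (simp add: \<psi>_def \<phi>_def \<rho>0 E_def)
  ultimately obtain e where e: "0 < e" "\<And>x. dist x x0 < e \<Longrightarrow> dist (\<psi> x) \<epsilon> < \<epsilon>"
    using \<epsilon>(1) unfolding continuous_at_eps_delta by metis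
  show ?thesis
  proof (rule that[OF 1, of "min e r1"])
    show "0 < min e r1" using e r1 by simp
    show "u x = 0" if "x \<in> \<Omega>" "r \<le> dist x0 x" for x
      using that r1 by (simp add: u_def)
    show "0 < u x" if "x \<in> \<Omega>" "dist x0 x < min e r1" for x
      using e(2)[of x] that F0' by (simp add: u_def dist_commute dist_real_def)
  qed
qed

theorem proposition12p9:
  fixes P :: "(real^'n::finite^'n) set" and \<Omega> :: "(real^'n) set"
  assumes "P \<subseteq> Sym2" and "closed P" and "convex P" and "cone P"
    and "positivity_condition P"
    and "open \<Omega>" and "connected \<Omega>" and "bounded \<Omega>"
    and "smooth_boundary \<Omega>" and "strictly_convex_boundary P \<Omega>"
  shows "convex_domain P \<Omega>"
proof -
  have "compact (closure (psh_hull P \<Omega> K)) \<and> closure (psh_hull P \<Omega> K) \<subseteq> \<Omega>"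
    if K: "compact K" "K \<subseteq> \<Omega>" for K
  proof
    have hull: "psh_hull P \<Omega> K \<subseteq> \<Omega>" by (auto simp: psh_hull_def)
    then show "compact (closure (psh_hull P \<Omega> K))"
      using assms(8) bounded_subset compact_closure by blast
    have "x0 \<notin> closure (psh_hull P \<Omega> K)" if x0: "x0 \<in> frontier \<Omega>" for x0
    proof (cases "K = {}")
      case True
      \<comment> \<open>The supremum over the empty set is some fixed number, which a constant function exceeds.\<close>
      have "0 \<in> P"
        using positivity_condition_nonempty assms(4,5) cone_contains_0 by blast
      then have "(\<lambda>x. c) \<in> PSH P \<Omega>" for c
        by (simp add: PSH_def smooth_on_const)
      from this[of "Sup {} + 1"] have "psh_hull P \<Omega> K = {}"
        unfolding psh_hull_def True by force
      then show ?thesis by simp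
    next
      case False
      \<comment> \<open>A barrier supported in a ball around \<open>x0\<close> that misses \<open>K\<close> vanishes on \<open>K\<close> and is positive near
        \<open>x0\<close>, hence keeps the hull away from \<open>x0\<close>.\<close>
      have "x0 \<notin> K" using x0 K assms(6) by (auto simp: frontier_def interior_open)
      then have "open (- K)" "x0 \<in> - K" using K compact_imp_closed by auto
      then obtain r where r: "0 < r" "ball x0 r \<subseteq> - K" using openE by blast
      have sc: "strictly_convex_at P \<Omega> x0"
        using assms(10) x0 by (simp add: strictly_convex_boundary_def)
      obtain u e where
        u: "u \<in> PSH P \<Omega>" "0 < e" "\<And>x. x \<in> \<Omega> \<Longrightarrow> r \<le> dist x0 x \<Longrightarrow> u x = 0"
        "\<And>x. x \<in> \<Omega> \<Longrightarrow> dist x0 x < e \<Longrightarrow> 0 < u x"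
        by (rule boundary_barrier[OF assms(1-6) x0 sc r(1)]) (assumption | rule that)+
      have "u y = 0" if "y \<in> K" for y
        using that r K u(3)[of y] by (force simp: not_less[symmetric])
      then have "(SUP y\<in>K. u y) = 0" using False by simp
      then have "psh_hull P \<Omega> K \<inter> ball x0 e = {}"
        using u(1,4) by (fastforce simp: psh_hull_def)
      then show ?thesis
        using u(2) by (metis Int_commute centre_in_ball closure_iff_nhds_not_empty inf.idem open_ball subset_refl)
    qed
    then show "closure (psh_hull P \<Omega> K) \<subseteq> \<Omega>"
      using closure_mono[OF hull] assms(6) by (auto simp: frontier_def interior_open)
  qed
  then show ?thesis using assms(6,7) by (simp add: convex_domain_def)
qed

end
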